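(* Let $A$ be a finite abelian group of order $n$ that is not an elementary abelian $2$-group, and let $D(A)=\langle x, A \mid x^2=1,\ xax=a^{-1} \text{ for all } a\in A\rangle$ be the generalised dihedral group over $A$. Consider the following two faithful transitive permutation actions of $D(A)$: (1) the regular action of $D(A)$ on itself by left multiplication (degree $2n$), and (2) the action of $D(A)$ by left multiplication on the set $D(A)/H$ of left cosets of $H=\langle x\rangle$ (degree $n$). In each of these two actions, $D(A)$ has the EKR property and is EKR robust.
   Context: For a finite transitive permutation group $G$ of degree $m$ acting on a set $\Omega$: a derangement is an element of $G$ with no fixed point in $\Omega$; $\mathrm{Der}(G)$ is the set of derangements. For an inverse-closed $S\subseteq G$ not containing the identity, $\mathrm{Cay}(G,S)$ is the graph with vertex set $G$ in which $g,h$ are adjacent iff $g^{-1}h\in S$. The derangement graph is $\Gamma_G=\mathrm{Cay}(G,\mathrm{Der}(G))$; $\alpha(\cdot)$ denotes independence number. $G$ has the EKR property if $\alpha(\Gamma_G)=|G|/m$. A label is a set $\{d,d^{-1}\}$ with $d\in\mathrm{Der}(G)$; the number of labels of a set $D\subseteq \mathrm{Der}(G)$ is $|\{\{d,d^{-1}\}: d\in D\}|$. For $i\ne j$ in $\Omega$ let $D_{i\to j}=\{d\in\mathrm{Der}(G): d(i)=j\}$, and let $\mathbf{d}_G=\min_{i\neq j}|\{\{d,d^{-1}\}: d\in D_{i\to j}\}|$. $G$ is EKR robust if $\alpha(\mathrm{Cay}(G,\mathrm{Der}(G)\setminus D))=|G|/m$ for every inverse-closed $D\subseteq\mathrm{Der}(G)$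 having fewer than $\mathbf{d}_G$ labels. *)

theory Defs
  imports
    "Graph_Theory.Pair_Digraph"
    "HOL-Algebra.Left_Coset"
    "HOL-Algebra.Generated_Groups"
    "HOL-Algebra.Group_Action"
begin

section \<open>Cayley graphs and independence number\<close>

text \<open>An undirected graph is represented by the digraph containing both orientations of
  every edge.  For \<open>S\<close> inverse-closed and without identity, the arc set below is symmetric
  and loop-free.\<close>

definition cayley_graph :: "('g, 'm) monoid_scheme \<Rightarrow> 'g set \<Rightarrow> 'g pair_pre_digraph" where
  "cayley_graph G S =
     \<lparr> pverts = carrier G,
       parcs = {(g, h). g \<in> carrier G \<and> h \<in> carrier G \<and> inv\<^bsub>G\<^esub> g \<otimes>\<^bsub>G\<^esub> h \<in> S} \<rparr>"

definition independent_set :: "'v pair_pre_digraph \<Rightarrow> 'v set \<Rightarrow> bool" where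
  "independent_set \<Gamma> I \<longleftrightarrow>
     I \<subseteq> pverts \<Gamma> \<and> (\<forall>u\<in>I. \<forall>v\<in>I. u \<noteq> v \<longrightarrow> (u, v) \<notin> parcs \<Gamma>)"

text \<open>Meaningful for graphs with finitely many vertices only.\<close>

definition independence_number :: "'v pair_pre_digraph \<Rightarrow> nat" where
  "independence_number \<Gamma> = Max {card I | I. independent_set \<Gamma> I}"


section \<open>The EKR property and EKR robustness of a group action\<close>

text \<open>Permutation groups are given, as in the library, by an action
  \<open>\<phi> : G \<rightarrow> Sym(E)\<close>; for a faithful action, \<open>G\<close> is identified with its image.\<close>

definition derangements ::
  "('g, 'm) monoid_scheme \<Rightarrow> 'e set \<Rightarrow> ('g \<Rightarrow> 'e \<Rightarrow> 'e) \<Rightarrow> 'g set" where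
  "derangements G E \<phi> = {g \<in> carrier G. \<forall>i\<in>E. \<phi> g i \<noteq> i}"

definition derangement_graph ::
  "('g, 'm) monoid_scheme \<Rightarrow> 'e set \<Rightarrow> ('g \<Rightarrow> 'e \<Rightarrow> 'e) \<Rightarrow> 'g pair_pre_digraph" where
  "derangement_graph G E \<phi> = cayley_graph G (derangements G E \<phi>)"

definition EKR_property ::
  "('g, 'm) monoid_scheme \<Rightarrow> 'e set \<Rightarrow> ('g \<Rightarrow> 'e \<Rightarrow> 'e) \<Rightarrow> bool" where
  "EKR_property G E \<phi> \<longleftrightarrow>
     real (independence_number (derangement_graph G E \<phi>)) = real (order G) / real (card E)"

definition labels :: "('g, 'm) monoid_scheme \<Rightarrow> 'g set \<Rightarrow> 'g set set" where
  "labels G D = {{d, inv\<^bsub>G\<^esub> d} | d. d \<in> D}"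

definition derangements_mapping ::
  "('g, 'm) monoid_scheme \<Rightarrow> 'e set \<Rightarrow> ('g \<Rightarrow> 'e \<Rightarrow> 'e) \<Rightarrow> 'e \<Rightarrow> 'e \<Rightarrow> 'g set" where
  "derangements_mapping G E \<phi> i j = {d \<in> derangements G E \<phi>. \<phi> d i = j}"

text \<open>Meaningful for finite \<open>E\<close> with at least two points only.\<close>

definition min_labels ::
  "('g, 'm) monoid_scheme \<Rightarrow> 'e set \<Rightarrow> ('g \<Rightarrow> 'e \<Rightarrow> 'e) \<Rightarrow> nat" where
  "min_labels G E \<phi> =
     Min {card (labels G (derangements_mapping G E \<phi> i j)) | i j. i \<in> E \<and> j \<in> E \<and> i \<noteq> j}"

definition inverse_closed :: "('g, 'm) monoid_scheme \<Rightarrow> 'g set \<Rightarrow> bool" where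
  "inverse_closed G S \<longleftrightarrow> (\<forall>s\<in>S. inv\<^bsub>G\<^esub> s \<in> S)"

definition EKR_robust ::
  "('g, 'm) monoid_scheme \<Rightarrow> 'e set \<Rightarrow> ('g \<Rightarrow> 'e \<Rightarrow> 'e) \<Rightarrow> bool" where
  "EKR_robust G E \<phi> \<longleftrightarrow>
     (\<forall>D. D \<subseteq> derangements G E \<phi> \<and> inverse_closed G D \<and>
          card (labels G D) < min_labels G E \<phi> \<longrightarrow>
        real (independence_number (cayley_graph G (derangements G E \<phi> - D)))
          = real (order G) / real (card E))"


section \<open>Left multiplication actions\<close>

text \<open>The maps are restricted because the library's symmetric group \<open>BijGroup\<close>
  consists of extensional functions.\<close>

definition left_regular_action :: "('g, 'm) monoid_scheme \<Rightarrow> 'g \<Rightarrow> 'g \<Rightarrow> 'g" where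
  "left_regular_action G g = (\<lambda>h\<in>carrier G. g \<otimes>\<^bsub>G\<^esub> h)"

definition left_coset_action ::
  "('g, 'm) monoid_scheme \<Rightarrow> 'g set \<Rightarrow> 'g \<Rightarrow> 'g set \<Rightarrow> 'g set" where
  "left_coset_action G H g = (\<lambda>C\<in>lcosets\<^bsub>G\<^esub> H. g <#\<^bsub>G\<^esub> C)"


section \<open>Groups given by generators and relations\<close>

text \<open>A letter \<open>(g, False)\<close> stands for the generator \<open>g\<close>, and \<open>(g, True)\<close> for its formal
  inverse.  A pair \<open>(r, s)\<close> in \<open>R\<close> stands for the relation \<open>r = s\<close>; both sides are
  expected to be words over \<open>X\<close>.\<close>

type_synonym 'g word = "('g \<times> bool) list"

definition words :: "'g set \<Rightarrow> 'g word set" where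
  "words X = lists (X \<times> UNIV)"

inductive pres_eq :: "'g set \<Rightarrow> ('g word \<times> 'g word) set \<Rightarrow> 'g word \<Rightarrow> 'g word \<Rightarrow> bool"
  for X R where
    refl: "w \<in> words X \<Longrightarrow> pres_eq X R w w"
  | sym: "pres_eq X R v w \<Longrightarrow> pres_eq X R w v"
  | trans: "pres_eq X R u v \<Longrightarrow> pres_eq X R v w \<Longrightarrow> pres_eq X R u w"
  | cancel: "u \<in> words X \<Longrightarrow> v \<in> words X \<Longrightarrow> g \<in> X \<Longrightarrow>
      pres_eq X R (u @ [(g, b), (g, \<not> b)] @ v) (u @ v)"
  | rel: "u \<in> words X \<Longrightarrow> v \<in> words X \<Longrightarrow> (r, s) \<in> R \<Longrightarrow>
      pres_eq X R (u @ r @ v) (u @ s @ v)"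

definition pres_class :: "'g set \<Rightarrow> ('g word \<times> 'g word) set \<Rightarrow> 'g word \<Rightarrow> 'g word set" where
  "pres_class X R w = {v. pres_eq X R w v}"

definition presented_group :: "'g set \<Rightarrow> ('g word \<times> 'g word) set \<Rightarrow> 'g word set monoid" where
  "presented_group X R =
     \<lparr> carrier = pres_class X R ` words X,
       mult = (\<lambda>P Q. \<Union>p\<in>P. \<Union>q\<in>Q. pres_class X R (p @ q)),
       one = pres_class X R [] \<rparr>"


section \<open>Generalised dihedral groups\<close>

datatype 'a dihedral_gen = Refl | Elt 'a

definition dihedral_gens :: "('a, 'm) monoid_scheme \<Rightarrow> 'a dihedral_gen set" where
  "dihedral_gens A = insert Refl (Elt ` carrier A)"

text \<open>The presentation \<open>\<langle>x, A | x\<^sup>2 = 1, x a x = a\<^sup>-\<^sup>1\<rangle>\<close>; the generator \<open>Refl\<close> is \<open>x\<close>,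
  and listing the group \<open>A\<close> among the generators means including its multiplication
  table among the relations.\<close>

definition dihedral_rels ::
  "('a, 'm) monoid_scheme \<Rightarrow> ('a dihedral_gen word \<times> 'a dihedral_gen word) set" where
  "dihedral_rels A =
     {([(Elt a, False), (Elt b, False)], [(Elt (a \<otimes>\<^bsub>A\<^esub> b), False)]) | a b.
        a \<in> carrier A \<and> b \<in> carrier A}
     \<union> {([(Refl, False), (Refl, False)], [])}
     \<union> {([(Refl, False), (Elt a, False), (Refl, False)], [(Elt a, True)]) | a. a \<in> carrier A}"

definition gen_dihedral :: "('a, 'm) monoid_scheme \<Rightarrow> 'a dihedral_gen word set monoid" where
  "gen_dihedral A = presented_group (dihedral_gens A) (dihedral_rels A)"

definition dihedral_x :: "('a, 'm) monoid_scheme \<Rightarrow> 'a dihedral_gen word set" where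
  "dihedral_x A = pres_class (dihedral_gens A) (dihedral_rels A) [(Refl, False)]"

definition dihedral_H :: "('a, 'm) monoid_scheme \<Rightarrow> 'a dihedral_gen word set set" where
  "dihedral_H A = generate (gen_dihedral A) {dihedral_x A}"


section \<open>Elementary abelian groups\<close>

text \<open>The trivial group counts as elementary abelian (of rank 0) for every prime.\<close>

definition elementary_abelian :: "nat \<Rightarrow> ('a, 'm) monoid_scheme \<Rightarrow> bool" where
  "elementary_abelian p A \<longleftrightarrow>
     comm_group A \<and> (\<forall>a\<in>carrier A. a [^]\<^bsub>A\<^esub> p = \<one>\<^bsub>A\<^esub>)"

end

theory Submission
  imports Defs
begin

text \<open>In both actions some \<open>D\<^bsub>i\<rightarrow>j\<^esub>\<close> consists of a single derangement, so that
  \<open>d\<^sub>G = 1\<close> and robustness reduces to the EKR property.  For the regular action this is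
  immediate; for the action on cosets of \<open>H = {1, x}\<close> one takes \<open>i = H\<close> and
  \<open>j = a\<^sup>2H\<close> with \<open>a\<^sup>2 \<noteq> 1\<close>, because \<open>a\<^sup>2x = axa\<^sup>-\<^sup>1\<close> has a fixed point.  The EKR
  property of the coset action holds because \<open>A\<close> acts regularly, hence is a clique, while
  \<open>H\<close> is independent of size 2.\<close>

section \<open>Independence numbers and robustness\<close>

text \<open>The cardinalities of independent sets are bounded because there are finitely many
  vertices, so \<open>Max\<close> is a genuine maximum.\<close>

lemma independence_number_eqI:
  assumes "finite (pverts \<Gamma>)" "independent_set \<Gamma> I"
    and "\<And>J. independent_set \<Gamma> J \<Longrightarrow> card J \<le> card I"
  shows "independence_number \<Gamma> = card I"
proof -
  have "{card J | J. independent_set \<Gamma> J} \<subseteq> card ` Pow (pverts \<Gamma>)"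
    by (auto simp: independent_set_def)
  then have "finite {card J | J. independent_set \<Gamma> J}"
    using assms(1) by (meson finite_Pow_iff finite_imageI finite_subset)
  then show ?thesis
    unfolding independence_number_def using assms(2,3) by (intro Max_eqI) auto
qed

lemma finite_labels: "finite D \<Longrightarrow> finite (labels G D)"
  by (simp add: labels_def Setcompr_eq_image)

text \<open>If some \<open>D\<^bsub>i\<rightarrow>j\<^esub>\<close> carries at most one label, then only the empty set has
  fewer than \<open>d\<^sub>G\<close> labels.\<close>

lemma EKR_robust_if_single_label:
  assumes "finite (carrier G)" "finite E" "EKR_property G E \<phi>"
    and "i \<in> E" "j \<in> E" "i \<noteq> j"
    and "derangements_mapping G E \<phi> i j \<subseteq> {d}"
  shows "EKR_robust G E \<phi>"
proof -
  let ?c = "\<lambda>i j. card (labels G (derangements_mapping G E \<phi> i j))"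
  have "{?c i j | i j. i \<in> E \<and> j \<in> E \<and> i \<noteq> j} \<subseteq> (\<lambda>(i, j). ?c i j) ` (E \<times> E)"
    by auto
  then have fin: "finite {?c i j | i j. i \<in> E \<and> j \<in> E \<and> i \<noteq> j}"
    by (rule finite_subset) (simp add: assms(2))
  have "labels G (derangements_mapping G E \<phi> i j) \<subseteq> {{d, inv\<^bsub>G\<^esub> d}}"
    using assms(7) by (auto simp: labels_def)
  then have "?c i j \<le> 1"
    using card_mono[of "{{d, inv\<^bsub>G\<^esub> d}}"] by simp
  then have min: "min_labels G E \<phi> \<le> 1"
    unfolding min_labels_def using Min_le[OF fin, of "?c i j"] assms(4-6) by fastforce
  have "D = {}" if "D \<subseteq> derangements G E \<phi>" "card (labels G D) < min_labels G E \<phi>" for D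
  proof -
    have "finite D"
      using that(1) assms(1) by (auto simp: derangements_def intro: finite_subset)
    then have "labels G D = {}"
      using that(2) min finite_labels[of D G] by (metis card_0_eq less_one order_less_le_trans)
    then show ?thesis
      by (auto simp: labels_def)
  qed
  then show ?thesis
    using assms(3) unfolding EKR_robust_def EKR_property_def derangement_graph_def
    by (metis Diff_empty)
qed


section \<open>Actions by left multiplication\<close>

text \<open>Each map is bijective because the map of the inverse element undoes it, by
  \<open>one\<close> and \<open>mult\<close>. Extensionality reduces equality in
  \<open>BijGroup E\<close> to equality on \<open>E\<close>.\<close>

lemma group_actionI:
  assumes "group G"
    and ext: "\<And>g. g \<in> carrier G \<Longrightarrow> \<phi> g \<in> extensional E"
    and closed: "\<And>g i. g \<in> carrier G \<Longrightarrow> i \<in> E \<Longrightarrow> \<phi> g i \<in> E"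
    and one: "\<And>i. i \<in> E \<Longrightarrow> \<phi> \<one>\<^bsub>G\<^esub> i = i"
    and mult: "\<And>g h i. g \<in> carrier G \<Longrightarrow> h \<in> carrier G \<Longrightarrow> i \<in> E \<Longrightarrow>
      \<phi> (g \<otimes>\<^bsub>G\<^esub> h) i = \<phi> g (\<phi> h i)"
  shows "group_action G E \<phi>"
proof -
  interpret group G by fact
  have bij: "\<phi> g \<in> Bij E" if g: "g \<in> carrier G" for g
  proof -
    have "\<phi> (inv\<^bsub>G\<^esub> g) (\<phi> g i) = i" "\<phi> g (\<phi> (inv\<^bsub>G\<^esub> g) i) = i" if "i \<in> E" for i
      using that g one by (simp_all flip: mult)
    then have "bij_betw (\<phi> g) E E"
      using closed g by (intro bij_betwI[where g = "\<phi> (inv\<^bsub>G\<^esub> g)"]) auto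
    then show ?thesis
      using ext g by (simp add: Bij_def)
  qed
  have "\<phi> (g \<otimes>\<^bsub>G\<^esub> h) = compose E (\<phi> g) (\<phi> h)" if "g \<in> carrier G" "h \<in> carrier G" for g h
    by (rule extensionalityI[where A = E]) (use that ext mult in \<open>auto simp: compose_eq\<close>)
  then have "\<phi> \<in> hom G (BijGroup E)"
    by (auto simp: hom_def BijGroup_def bij)
  then show ?thesis
    by (simp add: group_action_def group_hom_def group_hom_axioms_def group_BijGroup)
qed

context group
begin

lemma mult_inv_cancel:
  assumes "g \<in> carrier G" "h \<in> carrier G"
  shows "g \<otimes> (inv g \<otimes> h) = h" "inv g \<otimes> (g \<otimes> h) = h"
  using assms by (simp_all flip: m_assoc)

section \<open>The left regular action\<close>

lemma group_action_left_regular: "group_action G (carrier G) (left_regular_action G)"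
  by (rule group_actionI) (auto simp: left_regular_action_def m_assoc group_axioms)

text \<open>An element is recovered from its map as the image of \<open>\<one>\<close>.\<close>

lemma faithful_left_regular: "faithful_action G (carrier G) (left_regular_action G)"
proof -
  have "inj_on (left_regular_action G) (carrier G)"
    by (rule inj_onI) (metis left_regular_action_def one_closed r_one restrict_apply')
  then show ?thesis
    by (simp add: faithful_action_def faithful_action_axioms_def group_action_left_regular)
qed

lemma transitive_left_regular: "transitive_action G (carrier G) (left_regular_action G)"
proof -
  have "\<exists>g\<in>carrier G. left_regular_action G g a = b"
    if "a \<in> carrier G" "b \<in> carrier G" for a b
    using that by (intro bexI[of _ "b \<otimes> inv a"]) (auto simp: left_regular_action_def m_assoc)
  then show ?thesis
    by (simp add: transitive_action_def transitive_action_axioms_def group_action_left_regular)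
qed

lemma derangements_left_regular:
  "derangements G (carrier G) (left_regular_action G) = carrier G - {\<one>}"
  by (auto simp: derangements_def left_regular_action_def)

text \<open>All elements except \<open>\<one>\<close> are derangements, so the derangement graph is
  complete and no independent set has two vertices.\<close>

lemma EKR_property_left_regular:
  assumes "finite (carrier G)"
  shows "EKR_property G (carrier G) (left_regular_action G)"
proof -
  let ?\<Gamma> = "derangement_graph G (carrier G) (left_regular_action G)"
  have "card J \<le> card {\<one>}" if "independent_set ?\<Gamma> J" for J
  proof -
    have "g = h" if "g \<in> J" "h \<in> J" for g h
    proof (rule ccontr)
      assume "g \<noteq> h"
      have c: "g \<in> carrier G" "h \<in> carrier G"
        using that \<open>independent_set ?\<Gamma> J\<close>
        by (auto simp: independent_set_def derangement_graph_def cayley_graph_def)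
      then have "inv g \<otimes> h \<noteq> \<one>"
        using \<open>g \<noteq> h\<close> by (metis inv_solve_left one_closed r_one)
      then show False
        using that \<open>independent_set ?\<Gamma> J\<close> \<open>g \<noteq> h\<close> c
        by (auto simp: independent_set_def derangement_graph_def cayley_graph_def
            derangements_left_regular)
    qed
    moreover have "finite J"
      using that assms
      by (auto simp: independent_set_def derangement_graph_def cayley_graph_def intro: finite_subset)
    ultimately show ?thesis
      by (simp add: card_le_Suc0_iff_eq)
  qed
  then have "independence_number ?\<Gamma> = card {\<one>}"
    using assms by (intro independence_number_eqI)
      (auto simp: independent_set_def derangement_graph_def cayley_graph_def)
  \<comment> \<open>Since division by 0 yields 0, the ratio of order to degree is 1 only because the
    order is positive.\<close>
  moreover have "order G > 0"
    using assms by (simp add: order_gt_0_iff_finite)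
  ultimately show ?thesis
    by (simp add: EKR_property_def order_def)
qed

text \<open>Only \<open>a\<close> takes \<open>\<one>\<close> to \<open>a\<close>, which gives a
  single label.\<close>

lemma EKR_robust_left_regular:
  assumes "finite (carrier G)" "a \<in> carrier G" "a \<noteq> \<one>"
  shows "EKR_robust G (carrier G) (left_regular_action G)"
proof (rule EKR_robust_if_single_label[where i = \<one> and j = a and d = a])
  show "derangements_mapping G (carrier G) (left_regular_action G) \<one> a \<subseteq> {a}"
    by (auto simp: derangements_mapping_def derangements_left_regular left_regular_action_def)
qed (use assms EKR_property_left_regular in auto)

section \<open>The action on the left cosets of a subgroup\<close>

lemma lcoset_eq_iff:
  assumes "subgroup H G" "g \<in> carrier G" "h \<in> carrier G"
  shows "g <# H = h <# H \<longleftrightarrow> inv g \<otimes> h \<in> H"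
  using assms by (metis lcos_self l_repr_independence subgroup.lcos_module_imp
      subgroup.lcos_module_rev is_group)

lemma left_coset_action_lcoset:
  assumes "subgroup H G" "g \<in> carrier G" "b \<in> carrier G"
  shows "left_coset_action G H g (b <# H) = (g \<otimes> b) <# H"
  using assms lcos_m_assoc[of H g b] subgroup.subset[OF assms(1)]
  by (auto simp: left_coset_action_def LCOSETS_def)

text \<open>The stabiliser of \<open>b <# H\<close> is the conjugate of \<open>H\<close> by
  \<open>b\<close>. Through this criterion, questions about fixed points become questions about
  conjugates lying in \<open>H\<close>.\<close>

lemma left_coset_action_fixes_iff:
  assumes "subgroup H G" "g \<in> carrier G" "b \<in> carrier G"
  shows "left_coset_action G H g (b <# H) = b <# H \<longleftrightarrow> inv b \<otimes> g \<otimes> b \<in> H"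
  using assms lcoset_eq_iff[of H b "g \<otimes> b"]
  by (auto simp: left_coset_action_lcoset m_assoc)

lemma group_action_left_coset:
  assumes "subgroup H G"
  shows "group_action G (lcosets H) (left_coset_action G H)"
proof (rule group_actionI)
  fix g h i
  assume "g \<in> carrier G" "h \<in> carrier G" "i \<in> lcosets H"
  then show "left_coset_action G H (g \<otimes> h) i = left_coset_action G H g (left_coset_action G H h i)"
    using assms by (auto simp: LCOSETS_def left_coset_action_lcoset m_assoc)
next
  fix g i
  assume "g \<in> carrier G" "i \<in> lcosets H"
  then show "left_coset_action G H g i \<in> lcosets H"
    using assms by (auto simp: LCOSETS_def left_coset_action_lcoset)
next
  fix i
  assume "i \<in> lcosets H"
  then show "left_coset_action G H \<one> i = i"
    using assms by (auto simp: LCOSETS_def left_coset_action_lcoset)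
qed (auto simp: left_coset_action_def group_axioms)

lemma transitive_left_coset:
  assumes "subgroup H G"
  shows "transitive_action G (lcosets H) (left_coset_action G H)"
proof -
  have "\<exists>g\<in>carrier G. left_coset_action G H g i = j"
    if "i \<in> lcosets H" "j \<in> lcosets H" for i j
  proof -
    from that obtain a b where "a \<in> carrier G" "b \<in> carrier G" "i = a <# H" "j = b <# H"
      by (auto simp: LCOSETS_def)
    then show ?thesis
      using assms by (intro bexI[of _ "b \<otimes> inv a"]) (auto simp: left_coset_action_lcoset m_assoc)
  qed
  then show ?thesis
    using assms
    by (simp add: transitive_action_def transitive_action_axioms_def group_action_left_coset)
qed

end


section \<open>Groups inverting an index-two subgroup\<close>

text \<open>Isolates the properties of the generalised dihedral group behind the coset action:
  \<open>N\<close> is the copy of \<open>A\<close> and \<open>x\<close> the reflection. As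
  \<open>x\<close> is an involution, \<open>conj_x\<close> says that conjugation by \<open>x\<close>
  inverts \<open>N\<close>.\<close>

locale dihedral_extension = group G for G (structure) +
  fixes N x
  assumes finite_carrier: "finite (carrier G)"
    and N: "subgroup N G"
    and x: "x \<in> carrier G" "x \<notin> N" "x \<otimes> x = \<one>"
    and conj_x: "a \<in> N \<Longrightarrow> x \<otimes> a \<otimes> x = inv a"
    and index_two: "g \<in> carrier G \<Longrightarrow> g \<in> N \<or> g \<otimes> x \<in> N"
    and not_exponent_two: "\<exists>a\<in>N. a \<otimes> a \<noteq> \<one>"
begin

abbreviation "H \<equiv> generate G {x}"

section \<open>Computing with \<open>x\<close>, normality of \<open>N\<close>, order and
  degree\<close>

lemma inv_x: "inv x = x"
  using x by (simp add: inv_equality)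

lemma x_x_cancel: "g \<in> carrier G \<Longrightarrow> x \<otimes> (x \<otimes> g) = g" "g \<in> carrier G \<Longrightarrow> g \<otimes> x \<otimes> x = g"
  using x mult_inv_cancel(1)[of x g] by (simp_all add: m_assoc inv_x)

lemma mem_N: "a \<in> N \<Longrightarrow> a \<in> carrier G"
  by (rule subgroup.mem_carrier[OF N])

lemma H_eq: "H = {\<one>, x}"
proof
  have "subgroup {\<one>, x} G"
    using x by (auto simp: subgroup_def inv_x)
  then show "H \<subseteq> {\<one>, x}"
    using generate_subgroup_incl[of "{x}" "{\<one>, x}"] by simp
  show "{\<one>, x} \<subseteq> H"
    by (auto intro: generate.intros)
qed

lemma subgroup_H: "subgroup H G"
  using x generate_is_subgroup by simp

text \<open>As a rewrite rule, this moves \<open>x\<close> to the right past elements of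
  \<open>N\<close>.\<close>

lemma x_mult: "a \<in> N \<Longrightarrow> x \<otimes> a = inv a \<otimes> x"
  by (metis conj_x m_closed mem_N x(1) x_x_cancel(2))

text \<open>Normality of \<open>N\<close>, read from the conjugate back to the element.\<close>

lemma conj_N:
  assumes "b \<in> carrier G" "inv b \<otimes> g \<otimes> b \<in> N" "g \<in> carrier G"
  shows "g \<in> N"
proof -
  define c where "c = inv b \<otimes> g \<otimes> b"
  have c: "c \<in> N" "g = b \<otimes> c \<otimes> inv b"
    using assms by (auto simp: c_def m_assoc mult_inv_cancel)
  from index_two[OF assms(1)] show ?thesis
  proof
    assume "b \<in> N"
    then show ?thesis
      using c N by (simp add: subgroup.m_closed subgroup.m_inv_closed)
  next
    assume b: "b \<otimes> x \<in> N"
    \<comment> \<open>Replacing \<open>b\<close> by \<open>b \<otimes> x\<close> and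
      \<open>c\<close> by its conjugate under \<open>x\<close>, which is \<open>inv c\<close>,
      leaves only factors from \<open>N\<close>.\<close>
    have "g = (b \<otimes> x) \<otimes> (x \<otimes> c \<otimes> x) \<otimes> inv (b \<otimes> x)"
      using assms(1) c x mem_N[OF c(1)]
      by (simp add: inv_mult_group inv_x m_assoc x_x_cancel)
    then show ?thesis
      using b c N conj_x by (simp add: subgroup.m_closed subgroup.m_inv_closed)
  qed
qed

text \<open>The group is the disjoint union of \<open>N\<close> and its translate by
  \<open>x\<close>; a common element would put \<open>x\<close> into \<open>N\<close>.\<close>

lemma card_carrier: "card (carrier G) = 2 * card N"
proof -
  have "carrier G = N \<union> (\<lambda>a. a \<otimes> x) ` N"
  proof
    show "carrier G \<subseteq> N \<union> (\<lambda>a. a \<otimes> x) ` N"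
    proof
      fix g
      assume "g \<in> carrier G"
      then show "g \<in> N \<union> (\<lambda>a. a \<otimes> x) ` N"
        using index_two[of g] image_eqI[of g "\<lambda>a. a \<otimes> x" "g \<otimes> x" N] x_x_cancel(2)[of g]
        by auto
    qed
  qed (use x mem_N in auto)
  moreover have "N \<inter> (\<lambda>a. a \<otimes> x) ` N = {}"
  proof -
    have False if "a \<in> N" "a \<otimes> x \<in> N" for a
    proof -
      have "inv a \<otimes> (a \<otimes> x) \<in> N"
        using that N by (simp add: subgroup.m_closed subgroup.m_inv_closed)
      then show False
        using x mem_N[OF that(1)] by (simp flip: m_assoc)
    qed
    then show ?thesis by blast
  qed
  moreover have "inj_on (\<lambda>a. a \<otimes> x) N"
    using x mem_N by (auto intro: inj_onI)
  moreover have "finite N"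
    using finite_carrier N subgroup.subset finite_subset by blast
  ultimately show ?thesis
    by (simp add: card_Un_disjoint card_image)
qed

lemma card_lcosets: "card (lcosets H) = card N"
proof -
  have "\<one> \<noteq> x"
    using x N subgroup.one_closed by blast
  then show ?thesis
    using l_lagrange[OF finite_carrier subgroup_H] card_carrier by (simp add: H_eq order_def)
qed

text \<open>A fixed coset would give a conjugate of \<open>a\<close> in \<open>H\<close>. This
  conjugate is either \<open>\<one>\<close>, which forces \<open>a = \<one>\<close>, or
  \<open>x\<close>, which by normality would put \<open>x\<close> into \<open>N\<close>.\<close>

lemma derangement_N:
  assumes "a \<in> N" "a \<noteq> \<one>"
  shows "a \<in> derangements G (lcosets H) (left_coset_action G H)"
proof -
  have "inv b \<otimes> a \<otimes> b \<notin> H" if b: "b \<in> carrier G" for b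
  proof
    assume "inv b \<otimes> a \<otimes> b \<in> H"
    then consider "inv b \<otimes> a \<otimes> b = \<one>" | "inv b \<otimes> a \<otimes> b = x"
      by (auto simp: H_eq)
    then show False
    proof cases
      case 1
      have "a = b \<otimes> (inv b \<otimes> a \<otimes> b) \<otimes> inv b"
        using b mem_N[OF assms(1)] by (simp add: m_assoc mult_inv_cancel)
      then show False
        using 1 b assms(2) by simp
    next
      case 2
      have "inv (inv b) \<otimes> x \<otimes> inv b = a"
        using b mem_N[OF assms(1)] by (simp add: m_assoc mult_inv_cancel flip: 2)
      then show False
        using conj_N[of "inv b" x] assms(1) b x by auto
    qed
  qed
  then show ?thesis
    using mem_N[OF assms(1)] left_coset_action_fixes_iff[OF subgroup_H]
    by (auto simp: derangements_def LCOSETS_def)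
qed

lemma fixes_H_iff:
  "g \<in> carrier G \<Longrightarrow> left_coset_action G H g H = H \<longleftrightarrow> g \<in> H"
  using left_coset_action_fixes_iff[OF subgroup_H, of g \<one>] lcos_mult_one[of H]
    subgroup.subset[OF subgroup_H] by simp

lemma H_in_lcosets: "H \<in> lcosets H"
  using lcos_mult_one[of H] subgroup.subset[OF subgroup_H] by (auto simp: LCOSETS_def)

text \<open>The product reduces to \<open>a \<otimes> x \<otimes> a\<close>, and moving
  \<open>x\<close> past the last \<open>a\<close> inverts that factor.\<close>

lemma square_x_conj: "a \<in> N \<Longrightarrow> inv a \<otimes> (a \<otimes> a \<otimes> x) \<otimes> a = x"
  using x mem_N[of a] by (simp add: m_assoc x_mult mult_inv_cancel)

text \<open>An element of the kernel fixes \<open>H\<close>, so it is \<open>\<one>\<close> or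
  \<open>x\<close>. If \<open>x\<close> also fixed the coset of \<open>a\<close>, then
  \<open>inv (a \<otimes> a) \<otimes> x\<close> would lie in \<open>H\<close>, contradicting
  \<open>a \<otimes> a \<noteq> \<one>\<close> or \<open>x \<notin> N\<close>.\<close>

lemma faithful_left_coset: "faithful_action G (lcosets H) (left_coset_action G H)"
proof -
  let ?\<phi> = "left_coset_action G H"
  interpret act: group_action G "lcosets H" ?\<phi>
    by (rule group_action_left_coset[OF subgroup_H])
  have ker: "g = \<one>" if g: "g \<in> carrier G" and fixed: "\<And>i. i \<in> lcosets H \<Longrightarrow> ?\<phi> g i = i" for g
  proof (rule ccontr)
    assume "g \<noteq> \<one>"
    moreover have "g \<in> H"
      using fixes_H_iff[OF g] fixed H_in_lcosets by blast
    ultimately have "g = x"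
      by (simp add: H_eq)
    from not_exponent_two obtain a where a: "a \<in> N" "a \<otimes> a \<noteq> \<one>"
      by blast
    have "a <# H \<in> lcosets H"
      using mem_N[OF a(1)] by (auto simp: LCOSETS_def)
    then have "inv a \<otimes> x \<otimes> a \<in> H"
      using fixed left_coset_action_fixes_iff[OF subgroup_H g mem_N[OF a(1)]] \<open>g = x\<close> by simp
    moreover have "inv a \<otimes> x \<otimes> a = inv (a \<otimes> a) \<otimes> x"
      using a mem_N x by (simp add: m_assoc x_mult inv_mult_group)
    ultimately have "inv (a \<otimes> a) \<otimes> x = \<one> \<or> inv (a \<otimes> a) \<otimes> x = x"
      by (simp add: H_eq)
    then show False
    proof
      assume "inv (a \<otimes> a) \<otimes> x = \<one>"
      then have "x = a \<otimes> a"
        using a mem_N x by (metis inv_equality inv_inv inv_closed m_closed inv_x)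
      then show False
        using a(1) N x(2) subgroup.m_closed by metis
    next
      assume "inv (a \<otimes> a) \<otimes> x = x"
      then have "inv (a \<otimes> a) = \<one>"
        using a mem_N x by (metis inv_closed l_one m_closed one_closed right_cancel)
      then show False
        using a mem_N by (metis inv_inv inv_one m_closed)
    qed
  qed
  have "inj_on ?\<phi> (carrier G)"
  proof (rule inj_onI)
    fix g h
    assume gh: "g \<in> carrier G" "h \<in> carrier G" "?\<phi> g = ?\<phi> h"
    \<comment> \<open>Equal maps make \<open>inv h \<otimes> g\<close> fix every coset.\<close>
    then have "inv h \<otimes> g = \<one>"
      by (intro ker) (auto simp: act.composition_rule act.orbit_sym_aux)
    then show "g = h"
      using gh by (metis inv_closed inv_equality inv_inv)
  qed
  then show ?thesis
    by (simp add: faithful_action_def faithful_action_axioms_def act.group_action_axioms)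
qed

text \<open>Two elements in the same coset of \<open>N\<close> differ by a derangement, so an independent set
  meets each of the two cosets at most once.\<close>

lemma card_independent_set_le_2:
  assumes "independent_set (derangement_graph G (lcosets H) (left_coset_action G H)) J"
  shows "card J \<le> 2"
proof -
  have J: "J \<subseteq> carrier G"
    using assms by (simp add: independent_set_def derangement_graph_def cayley_graph_def)
  have eq: "g = h" if gh: "g \<in> J" "h \<in> J" "inv g \<otimes> h \<in> N" for g h
  proof (rule ccontr)
    assume "g \<noteq> h"
    then have "inv g \<otimes> h \<noteq> \<one>"
      using gh J by (metis inv_solve_left one_closed r_one subsetD)
    then show False
      using derangement_N[OF gh(3)] gh assms \<open>g \<noteq> h\<close> J
      by (auto simp: independent_set_def derangement_graph_def cayley_graph_def)
  qed
  have "g = h" if "g \<in> J \<inter> N" "h \<in> J \<inter> N" for g h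
    using that N by (intro eq) (auto simp: subgroup.m_closed subgroup.m_inv_closed)
  then have 1: "card (J \<inter> N) \<le> 1"
    by (metis card_le_Suc0_iff_eq One_nat_def finite_Int finite_subset J finite_carrier)
  have "g = h" if "g \<in> J - N" "h \<in> J - N" for g h
  proof (rule eq)
    have c: "g \<in> carrier G" "h \<in> carrier G"
      using that J by auto
    have "g \<otimes> x \<in> N" "h \<otimes> x \<in> N"
      using that c index_two by auto
    \<comment> \<open>The bracket equals \<open>x \<otimes> (inv g \<otimes> h) \<otimes> x\<close>
      and lies in \<open>N\<close>; conjugating once more by \<open>x\<close> stays in
      \<open>N\<close> and recovers \<open>inv g \<otimes> h\<close>.\<close>
    then have "x \<otimes> (inv (g \<otimes> x) \<otimes> (h \<otimes> x)) \<otimes> x \<in> N"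
      using conj_x N by (simp add: subgroup.m_closed subgroup.m_inv_closed)
    then show "inv g \<otimes> h \<in> N"
      using c x by (simp add: inv_mult_group inv_x m_assoc x_x_cancel)
  qed (use that in auto)
  then have 2: "card (J - N) \<le> 1"
    by (metis card_le_Suc0_iff_eq One_nat_def finite_Diff finite_subset J finite_carrier)
  have "card J = card (J \<inter> N) + card (J - N)"
    using J finite_carrier by (metis card_Int_Diff finite_subset)
  then show ?thesis
    using 1 2 by simp
qed

lemma EKR_property_left_coset: "EKR_property G (lcosets H) (left_coset_action G H)"
proof -
  let ?\<Gamma> = "derangement_graph G (lcosets H) (left_coset_action G H)"
  have "\<one> \<noteq> x"
    using x N subgroup.one_closed by blast
  then have two: "card {\<one>, x} = 2"
    by simp
  have "x \<notin> derangements G (lcosets H) (left_coset_action G H)"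
    using H_in_lcosets fixes_H_iff[OF x(1)] H_eq by (auto simp: derangements_def)
  then have "independent_set ?\<Gamma> {\<one>, x}"
    using x by (auto simp: independent_set_def derangement_graph_def cayley_graph_def inv_x)
  then have "independence_number ?\<Gamma> = card {\<one>, x}"
    using finite_carrier card_independent_set_le_2 two
    by (intro independence_number_eqI) (auto simp: derangement_graph_def cayley_graph_def)
  \<comment> \<open>The ratio to be evaluated is \<open>2 * card N / card N\<close>, so a zero
    denominator has to be excluded.\<close>
  moreover have "card N > 0"
    using card_carrier finite_carrier by (metis card_gt_0_iff empty_iff mult_0_right neq0_conv one_closed)
  ultimately show ?thesis
    using two by (simp add: EKR_property_def order_def card_carrier card_lcosets)
qed

text \<open>For \<open>a\<^sup>2 \<noteq> 1\<close> the elements taking \<open>H\<close> to \<open>a\<^sup>2H\<close> are \<open>a\<^sup>2\<close> and \<open>a\<^sup>2x\<close>,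
  and the latter is no derangement, being conjugate to \<open>x\<close>.\<close>

lemma EKR_robust_left_coset: "EKR_robust G (lcosets H) (left_coset_action G H)"
proof -
  let ?\<phi> = "left_coset_action G H"
  from not_exponent_two obtain a where a: "a \<in> N" "a \<otimes> a \<noteq> \<one>"
    by blast
  have c: "a \<in> carrier G" and aa: "a \<otimes> a \<in> N"
    using a mem_N N by (auto simp: subgroup.m_closed)
  \<comment> \<open>\<open>H\<close> meets \<open>N\<close> only in \<open>\<one>\<close>; hence the
    two chosen points are distinct.\<close>
  have "a \<otimes> a \<notin> H"
    using a x aa by (auto simp: H_eq)
  then have neq: "H \<noteq> (a \<otimes> a) <# H"
    using lcos_self[OF _ subgroup_H, of "a \<otimes> a"] c by auto
  have "d = a \<otimes> a" if d: "d \<in> derangements_mapping G (lcosets H) ?\<phi> H ((a \<otimes> a) <# H)" for d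
  proof -
    have dc: "d \<in> carrier G" "?\<phi> d H = (a \<otimes> a) <# H"
      using d by (auto simp: derangements_mapping_def derangements_def)
    then have "d <# H = (a \<otimes> a) <# H"
      using H_in_lcosets by (simp add: left_coset_action_def)
    then have "d \<in> (a \<otimes> a) <# H"
      using lcos_self[OF dc(1) subgroup_H] by simp
    then consider "d = a \<otimes> a" | "d = a \<otimes> a \<otimes> x"
      using c by (auto simp: l_coset_def H_eq)
    then show ?thesis
    proof cases
      case 2
      then have "inv a \<otimes> d \<otimes> a \<in> H"
        using square_x_conj[OF a(1)] by (simp add: H_eq)
      then have "?\<phi> d (a <# H) = a <# H"
        using left_coset_action_fixes_iff[OF subgroup_H dc(1) c] by simp
      then have False
        using d c by (auto simp: derangements_mapping_def derangements_def LCOSETS_def)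
      then show ?thesis ..
    qed
  qed
  then have "derangements_mapping G (lcosets H) ?\<phi> H ((a \<otimes> a) <# H) \<subseteq> {a \<otimes> a}"
    by blast
  moreover have "finite (lcosets H)"
    using finite_carrier by (simp add: LCOSETS_def)
  moreover have "(a \<otimes> a) <# H \<in> lcosets H"
    using c by (auto simp: LCOSETS_def)
  ultimately show ?thesis
    using finite_carrier EKR_property_left_coset H_in_lcosets neq
    by (intro EKR_robust_if_single_label[where i = H and j = "(a \<otimes> a) <# H" and d = "a \<otimes> a"])
qed

end


section \<open>Presented groups\<close>

lemma words_append [simp]: "u @ v \<in> words X \<longleftrightarrow> u \<in> words X \<and> v \<in> words X"
  by (auto simp: words_def)

lemma words_Nil [simp]: "[] \<in> words X"
  by (simp add: words_def)

lemma words_Cons [simp]: "(g, b) # w \<in> words X \<longleftrightarrow> g \<in> X \<and> w \<in> words X"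
  by (auto simp: words_def)

definition inv_word :: "'g word \<Rightarrow> 'g word" where
  "inv_word w = rev (map (\<lambda>(g, b). (g, \<not> b)) w)"

lemma inv_word_words [simp]: "inv_word w \<in> words X \<longleftrightarrow> w \<in> words X"
  by (induction w) (auto simp: inv_word_def)

text \<open>The homomorphism from the free group that extends \<open>f\<close>, computed on
  unreduced words.\<close>

fun eval_word :: "('b, 'm) monoid_scheme \<Rightarrow> ('g \<Rightarrow> 'b) \<Rightarrow> 'g word \<Rightarrow> 'b" where
  "eval_word K f [] = \<one>\<^bsub>K\<^esub>"
| "eval_word K f ((g, b) # w) = (if b then inv\<^bsub>K\<^esub> (f g) else f g) \<otimes>\<^bsub>K\<^esub> eval_word K f w"

lemma (in group) eval_word_closed:
  "f \<in> X \<rightarrow> carrier G \<Longrightarrow> w \<in> words X \<Longrightarrow> eval_word G f w \<in> carrier G"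
  by (induction w) (auto simp: Pi_iff)

lemma (in group) eval_word_append:
  "f \<in> X \<rightarrow> carrier G \<Longrightarrow> u \<in> words X \<Longrightarrow> v \<in> words X \<Longrightarrow>
    eval_word G f (u @ v) = eval_word G f u \<otimes> eval_word G f v"
  by (induction u) (auto simp: Pi_iff eval_word_closed m_assoc)

text \<open>The rule \<open>rel\<close> does not check that its relators are words over
  \<open>X\<close>; the assumption keeps \<open>pres_eq\<close> among such words.\<close>

locale presentation =
  fixes X :: "'g set" and R :: "('g word \<times> 'g word) set"
  assumes rels_words: "R \<subseteq> words X \<times> words X"
begin

abbreviation "P \<equiv> presented_group X R"
abbreviation "cls \<equiv> pres_class X R"

section \<open>The group of word classes and its universal property\<close>

lemma pres_eq_words: "pres_eq X R u v \<Longrightarrow> u \<in> words X \<and> v \<in> words X"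
  by (induction rule: pres_eq.induct) (use rels_words in auto)

text \<open>The rules allow any left context, so \<open>w\<close> is absorbed into it. Together with
  the version on the right, this makes the product of classes well defined.\<close>

lemma pres_eq_append_left:
  "pres_eq X R u v \<Longrightarrow> w \<in> words X \<Longrightarrow> pres_eq X R (w @ u) (w @ v)"
proof (induction rule: pres_eq.induct)
  case (cancel u v g b)
  then show ?case
    using pres_eq.cancel[of "w @ u" X v g R b] by simp
next
  case (rel u v r s)
  then show ?case
    using pres_eq.rel[of "w @ u" X v r s R] by simp
next
  case (trans u v z)
  then show ?case
    using pres_eq.trans by metis
next
  case (sym u v)
  then show ?case
    using pres_eq.sym by metis
qed (simp add: pres_eq.refl)

lemma pres_eq_append_right:
  "pres_eq X R u v \<Longrightarrow> w \<in> words X \<Longrightarrow> pres_eq X R (u @ w) (v @ w)"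
proof (induction rule: pres_eq.induct)
  case (cancel u v g b)
  then show ?case
    using pres_eq.cancel[of u X "v @ w" g R b] by simp
next
  case (rel u v r s)
  then show ?case
    using pres_eq.rel[of u X "v @ w" r s R] by simp
next
  case (trans u v z)
  then show ?case
    using pres_eq.trans by metis
next
  case (sym u v)
  then show ?case
    using pres_eq.sym by metis
qed (simp add: pres_eq.refl)

lemma cls_eq_iff: "u \<in> words X \<Longrightarrow> v \<in> words X \<Longrightarrow> cls u = cls v \<longleftrightarrow> pres_eq X R u v"
proof
  assume "v \<in> words X" "cls u = cls v"
  then show "pres_eq X R u v"
    using pres_eq.refl[of v X R] by (auto simp: pres_class_def)
next
  assume "pres_eq X R u v"
  then have "pres_eq X R u w \<longleftrightarrow> pres_eq X R v w" for w
    by (metis pres_eq.sym pres_eq.trans)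
  then show "cls u = cls v"
    by (simp add: pres_class_def)
qed

lemma cls_rel: "(r, s) \<in> R \<Longrightarrow> cls r = cls s"
  using pres_eq.rel[of "[]" X "[]" r s R] rels_words by (subst cls_eq_iff) auto

lemma cls_closed [simp]: "w \<in> words X \<Longrightarrow> cls w \<in> carrier P"
  by (simp add: presented_group_def)

lemma one_P: "\<one>\<^bsub>P\<^esub> = cls []"
  by (simp add: presented_group_def)

text \<open>The product is a union over all pairs of representatives; by congruence the classes
  united all coincide.\<close>

lemma mult_cls:
  assumes "u \<in> words X" "v \<in> words X"
  shows "cls u \<otimes>\<^bsub>P\<^esub> cls v = cls (u @ v)"
proof -
  have "cls (p @ q) = cls (u @ v)" if "p \<in> cls u" "q \<in> cls v" for p q
  proof -
    have pq: "pres_eq X R u p" "pres_eq X R v q"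
      using that by (auto simp: pres_class_def)
    then have "pres_eq X R (u @ v) (p @ q)"
      using pres_eq_append_left pres_eq_append_right pres_eq_words assms
      by (meson pres_eq.trans)
    then show ?thesis
      using pres_eq_words cls_eq_iff by metis
  qed
  moreover have "u \<in> cls u" "v \<in> cls v"
    using assms by (auto simp: pres_class_def intro: pres_eq.refl)
  ultimately have "(\<Union>p\<in>cls u. \<Union>q\<in>cls v. cls (p @ q)) = cls (u @ v)"
    by blast
  then show ?thesis
    by (simp add: presented_group_def)
qed

lemma carrier_P: "carrier P = cls ` words X"
  by (simp add: presented_group_def)

lemma inv_word_cancel: "w \<in> words X \<Longrightarrow> pres_eq X R (inv_word w @ w) []"
proof (induction w)
  case Nil
  then show ?case
    by (simp add: inv_word_def pres_eq.refl)
next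
  case (Cons l w)
  obtain g b where l: "l = (g, b)"
    by fastforce
  \<comment> \<open>The first letter of the word meets its formal inverse in the middle;
    \<open>\<not> \<not> b\<close> fits the shape of \<open>cancel\<close>.\<close>
  have "pres_eq X R (inv_word w @ [(g, \<not> b), (g, \<not> \<not> b)] @ w) (inv_word w @ w)"
    using Cons.prems l by (intro pres_eq.cancel) auto
  then show ?case
    using pres_eq.trans[OF _ Cons.IH] Cons.prems l by (simp add: inv_word_def)
qed

lemma group_P: "group P"
proof (rule groupI)
  fix p
  assume "p \<in> carrier P"
  then obtain w where w: "w \<in> words X" "p = cls w"
    by (auto simp: carrier_P)
  then have "cls (inv_word w) \<otimes>\<^bsub>P\<^esub> p = \<one>\<^bsub>P\<^esub>"
    using inv_word_cancel[of w] by (simp add: mult_cls one_P cls_eq_iff)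
  then show "\<exists>q\<in>carrier P. q \<otimes>\<^bsub>P\<^esub> p = \<one>\<^bsub>P\<^esub>"
    using w by (metis cls_closed inv_word_words)
qed (auto simp: carrier_P one_P mult_cls)

lemma inv_generator: "g \<in> X \<Longrightarrow> cls [(g, True)] = inv\<^bsub>P\<^esub> (cls [(g, False)])"
  using pres_eq.cancel[of "[]" X "[]" g R True]
  by (intro group.inv_equality[OF group_P, symmetric]) (simp_all add: mult_cls one_P cls_eq_iff)

text \<open>Von Dyck's principle: if the relations hold in \<open>K\<close>, evaluation is constant
  on classes. Different values therefore separate classes.\<close>

lemma eval_word_cong:
  assumes "group K" "f \<in> X \<rightarrow> carrier K"
    and "\<And>r s. (r, s) \<in> R \<Longrightarrow> eval_word K f r = eval_word K f s"
    and "pres_eq X R u v"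
  shows "eval_word K f u = eval_word K f v"
proof -
  interpret K: group K by fact
  note app = K.eval_word_append[OF assms(2)] and closed = K.eval_word_closed[OF assms(2)]
  show ?thesis
    using assms(4)
  proof (induction rule: pres_eq.induct)
    case (cancel u v g b)
    have g: "f g \<in> carrier K"
      using assms(2) cancel by auto
    have "eval_word K f ([(g, b), (g, \<not> b)] @ v) = eval_word K f v"
      using cancel g closed by (auto simp flip: K.m_assoc)
    then show ?case
      using cancel by (simp add: app)
  next
    case (rel u v r s)
    then show ?case
      using rels_words assms(3)[of r s] by (auto simp: app)
  qed auto
qed

end


section \<open>Generalised dihedral groups\<close>

text \<open>The semidirect product \<open>A \<rtimes> C\<^sub>2\<close>, with \<open>(a, s)\<close> standing for \<open>ax\<^sup>s\<close>.  Evaluating words in it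
  shows that the presentation collapses neither \<open>A\<close> nor \<open>x\<close>.\<close>

definition dihedral_model :: "('a, 'm) monoid_scheme \<Rightarrow> ('a \<times> bool) monoid" where
  "dihedral_model A =
     \<lparr> carrier = carrier A \<times> UNIV,
       mult = (\<lambda>(a, s) (b, t). (a \<otimes>\<^bsub>A\<^esub> (if s then inv\<^bsub>A\<^esub> b else b), s \<noteq> t)),
       one = (\<one>\<^bsub>A\<^esub>, False) \<rparr>"

lemma group_dihedral_model:
  assumes "comm_group A"
  shows "group (dihedral_model A)"
proof -
  interpret A: comm_group A by fact
  show ?thesis
  proof (rule groupI)
    fix p
    assume "p \<in> carrier (dihedral_model A)"
    then obtain a s where "p = (a, s)" "a \<in> carrier A"
      by (auto simp: dihedral_model_def)
    then show "\<exists>q\<in>carrier (dihedral_model A).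
        q \<otimes>\<^bsub>dihedral_model A\<^esub> p = \<one>\<^bsub>dihedral_model A\<^esub>"
      \<comment> \<open>Elements with flag \<open>True\<close> are involutions, hence their own
        inverses.\<close>
      by (intro bexI[of _ "(if s then a else inv\<^bsub>A\<^esub> a, s)"]) (auto simp: dihedral_model_def)
  qed (auto simp: dihedral_model_def A.m_assoc A.inv_mult)
qed

primrec model_gen :: "('a, 'm) monoid_scheme \<Rightarrow> 'a dihedral_gen \<Rightarrow> 'a \<times> bool" where
  "model_gen A Refl = (\<one>\<^bsub>A\<^esub>, True)"
| "model_gen A (Elt a) = (a, False)"

context comm_group
begin

sublocale pres: presentation "dihedral_gens G" "dihedral_rels G"
  by unfold_locales (auto simp: dihedral_rels_def dihedral_gens_def)

lemma dihedral_rels_mem [simp]: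
  "a \<in> carrier G \<Longrightarrow> b \<in> carrier G \<Longrightarrow>
    ([(Elt a, False), (Elt b, False)], [(Elt (a \<otimes> b), False)]) \<in> dihedral_rels G"
  "([(Refl, False), (Refl, False)], []) \<in> dihedral_rels G"
  "a \<in> carrier G \<Longrightarrow>
    ([(Refl, False), (Elt a, False), (Refl, False)], [(Elt a, True)]) \<in> dihedral_rels G"
  by (auto simp: dihedral_rels_def)

abbreviation "rot a \<equiv> pres.cls [(Elt a, False)]"
abbreviation "DG \<equiv> gen_dihedral G"

lemma group_DG: "group DG"
  using pres.group_P by (simp add: gen_dihedral_def)

lemma letter_words [simp]:
  "a \<in> carrier G \<Longrightarrow> Elt a \<in> dihedral_gens G" "Refl \<in> dihedral_gens G"
  by (auto simp: dihedral_gens_def)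

lemma rot_closed [simp]: "a \<in> carrier G \<Longrightarrow> rot a \<in> carrier DG"
  by (simp add: gen_dihedral_def)

lemma dihedral_x_closed [simp]: "dihedral_x G \<in> carrier DG"
  by (simp add: gen_dihedral_def dihedral_x_def)

lemma rot_mult:
  assumes "a \<in> carrier G" "b \<in> carrier G"
  shows "rot a \<otimes>\<^bsub>DG\<^esub> rot b = rot (a \<otimes> b)"
  using assms pres.cls_rel[of "[(Elt a, False), (Elt b, False)]" "[(Elt (a \<otimes> b), False)]"]
  by (simp add: gen_dihedral_def pres.mult_cls)

text \<open>The multiplication table of the group is among the relations. The image of this
  homomorphism later serves as \<open>N\<close>.\<close>

lemma rot_hom: "group_hom G DG rot"
  using group_DG group_axioms
  by (auto simp: group_hom_def group_hom_axioms_def hom_def rot_mult)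

lemma rot_inv: "a \<in> carrier G \<Longrightarrow> rot (inv a) = inv\<^bsub>DG\<^esub> (rot a)"
  by (rule group_hom.hom_inv[OF rot_hom])

lemma dihedral_x_square: "dihedral_x G \<otimes>\<^bsub>DG\<^esub> dihedral_x G = \<one>\<^bsub>DG\<^esub>"
  using pres.cls_rel[of "[(Refl, False), (Refl, False)]" "[]"]
  by (simp add: gen_dihedral_def dihedral_x_def pres.mult_cls pres.one_P)

lemma dihedral_x_conj:
  assumes "a \<in> carrier G"
  shows "dihedral_x G \<otimes>\<^bsub>DG\<^esub> rot a \<otimes>\<^bsub>DG\<^esub> dihedral_x G = inv\<^bsub>DG\<^esub> (rot a)"
  using assms pres.inv_generator[of "Elt a"]
    pres.cls_rel[of "[(Refl, False), (Elt a, False), (Refl, False)]" "[(Elt a, True)]"]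
  by (simp add: gen_dihedral_def dihedral_x_def pres.mult_cls)

lemma pres_eq_eval_model:
  assumes "pres_eq (dihedral_gens G) (dihedral_rels G) u v"
  shows "eval_word (dihedral_model G) (model_gen G) u = eval_word (dihedral_model G) (model_gen G) v"
proof (rule pres.eval_word_cong[OF _ _ _ assms])
  interpret M: group "dihedral_model G"
    by (rule group_dihedral_model[OF comm_group_axioms])
  show "group (dihedral_model G)"
    by (rule M.group_axioms)
  show "model_gen G \<in> dihedral_gens G \<rightarrow> carrier (dihedral_model G)"
    by (auto simp: dihedral_gens_def dihedral_model_def)
  \<comment> \<open>The relation for \<open>x a x\<close> has a formally inverted letter on its
    right, which evaluates to such an inverse.\<close>
  have inv: "inv\<^bsub>dihedral_model G\<^esub> (a, False) = (inv a, False)" if "a \<in> carrier G" for a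
    using that by (intro M.inv_equality) (auto simp: dihedral_model_def)
  show "eval_word (dihedral_model G) (model_gen G) r = eval_word (dihedral_model G) (model_gen G) s"
    if "(r, s) \<in> dihedral_rels G" for r s
    using that by (auto simp: dihedral_rels_def inv) (auto simp: dihedral_model_def)
qed

lemma rot_inj: "inj_on rot (carrier G)"
proof (rule inj_onI)
  fix a b
  assume "a \<in> carrier G" "b \<in> carrier G" "rot a = rot b"
  then show "a = b"
    using pres_eq_eval_model[of "[(Elt a, False)]" "[(Elt b, False)]"]
    by (auto simp: pres.cls_eq_iff dihedral_model_def)
qed

text \<open>The flag of the value in the model is \<open>True\<close> for the reflection and
  \<open>False\<close> for every rotation.\<close>

lemma dihedral_x_not_rot: "dihedral_x G \<notin> rot ` carrier G"
  using pres_eq_eval_model[of "[(Refl, False)]" "[(Elt a, False)]" for a]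
  by (auto simp: dihedral_x_def pres.cls_eq_iff dihedral_model_def)

text \<open>Every element has the form \<open>a\<close> or \<open>a x\<close>: the set
  \<open>?S\<close> of such elements contains the identity and is closed under left multiplication
  by generators and their inverses, so induction on words reaches everything.\<close>

lemma dihedral_cases:
  assumes "g \<in> carrier DG"
  shows "g \<in> rot ` carrier G \<or> g \<otimes>\<^bsub>DG\<^esub> dihedral_x G \<in> rot ` carrier G"
proof -
  let ?x = "dihedral_x G"
  let ?S = "{g \<in> carrier DG. g \<in> rot ` carrier G \<or> g \<otimes>\<^bsub>DG\<^esub> ?x \<in> rot ` carrier G}"
  interpret D: group DG by (rule group_DG)
  have left_rot: "rot a \<otimes>\<^bsub>DG\<^esub> g \<in> ?S" if "a \<in> carrier G" "g \<in> ?S" for a g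
  proof -
    have gc: "g \<in> carrier DG" and "g \<in> rot ` carrier G \<or> g \<otimes>\<^bsub>DG\<^esub> ?x \<in> rot ` carrier G"
      using that by simp_all
    then show ?thesis
    proof (elim disjE imageE)
      fix b
      assume b: "g = rot b" "b \<in> carrier G"
      then have "rot a \<otimes>\<^bsub>DG\<^esub> g = rot (a \<otimes> b)"
        using that(1) by (simp add: rot_mult)
      then show ?thesis
        using b that(1) gc by simp
    next
      fix b
      assume b: "g \<otimes>\<^bsub>DG\<^esub> ?x = rot b" "b \<in> carrier G"
      then have "rot a \<otimes>\<^bsub>DG\<^esub> g \<otimes>\<^bsub>DG\<^esub> ?x = rot (a \<otimes> b)"
        using that(1) gc by (simp add: D.m_assoc rot_mult)
      then show ?thesis
        using b that(1) gc by simp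
    qed
  qed
  have left_x: "?x \<otimes>\<^bsub>DG\<^esub> g \<in> ?S" if g: "g \<in> ?S" for g
  proof -
    have gc: "g \<in> carrier DG" and "g \<in> rot ` carrier G \<or> g \<otimes>\<^bsub>DG\<^esub> ?x \<in> rot ` carrier G"
      using g by simp_all
    then show ?thesis
    proof (elim disjE imageE)
      fix a
      assume a: "g = rot a" "a \<in> carrier G"
      then have "?x \<otimes>\<^bsub>DG\<^esub> g \<otimes>\<^bsub>DG\<^esub> ?x = rot (inv a)"
        by (simp add: dihedral_x_conj rot_inv)
      then show ?thesis
        using a(2) gc by simp
    next
      fix a
      assume a: "g \<otimes>\<^bsub>DG\<^esub> ?x = rot a" "a \<in> carrier G"
      \<comment> \<open>Inserting the square of the reflection on the right places
        \<open>rot a\<close> between two reflections, where the defining relation applies.\<close>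
      have "?x \<otimes>\<^bsub>DG\<^esub> g = ?x \<otimes>\<^bsub>DG\<^esub> (g \<otimes>\<^bsub>DG\<^esub> ?x) \<otimes>\<^bsub>DG\<^esub> ?x"
        using gc by (simp add: D.m_assoc dihedral_x_square)
      also have "\<dots> = rot (inv a)"
        using a by (simp add: dihedral_x_conj rot_inv)
      finally show ?thesis
        using a(2) gc by simp
    qed
  qed
  have "pres.cls w \<in> ?S" if "w \<in> words (dihedral_gens G)" for w
    using that
  proof (induction w)
    case Nil
    have "pres.cls [] = rot \<one>"
      using group_hom.hom_one[OF rot_hom] pres.one_P by (simp add: gen_dihedral_def)
    then show ?case
      by auto
  next
    case (Cons l w)
    obtain g b where l: "l = (g, b)" "g \<in> dihedral_gens G"
      using Cons.prems by (cases l) auto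
    have split: "pres.cls (l # w) = pres.cls [l] \<otimes>\<^bsub>DG\<^esub> pres.cls w"
      using Cons.prems l by (simp add: gen_dihedral_def pres.mult_cls)
    have w: "pres.cls w \<in> ?S"
      using Cons l by simp
    show ?case
    proof (cases g)
      case Refl
      have "inv\<^bsub>DG\<^esub> ?x = ?x"
        by (simp add: D.inv_equality dihedral_x_square)
      then have "pres.cls [l] = ?x"
        using Refl l pres.inv_generator[of Refl]
        by (cases b) (simp_all add: gen_dihedral_def dihedral_x_def)
      then show ?thesis
        using left_x[OF w] split by simp
    next
      case (Elt a)
      then have a: "a \<in> carrier G"
        using l by (auto simp: dihedral_gens_def)
      have "pres.cls [l] = rot (if b then inv a else a)"
        using Elt l a pres.inv_generator[of "Elt a"]
        by (cases b) (simp_all add: rot_inv flip: gen_dihedral_def)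
      then show ?thesis
        using left_rot[OF _ w, of "if b then inv a else a"] a split by simp
    qed
  qed
  then show ?thesis
    using assms by (auto simp: gen_dihedral_def pres.carrier_P)
qed

lemma dihedral_extension_gen_dihedral:
  assumes "finite (carrier G)" "\<not> elementary_abelian 2 G"
  shows "dihedral_extension DG (rot ` carrier G) (dihedral_x G)"
proof -
  interpret D: group DG by (rule group_DG)
  interpret rot: group_hom G DG rot by (rule rot_hom)
  show ?thesis
  proof (intro dihedral_extension.intro dihedral_extension_axioms.intro)
    have "carrier DG \<subseteq> rot ` carrier G \<union> (\<lambda>a. rot a \<otimes>\<^bsub>DG\<^esub> dihedral_x G) ` carrier G"
    proof
      fix g
      assume g: "g \<in> carrier DG"
      then have "g = g \<otimes>\<^bsub>DG\<^esub> dihedral_x G \<otimes>\<^bsub>DG\<^esub> dihedral_x G"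
        by (simp add: D.m_assoc dihedral_x_square)
      then show "g \<in> rot ` carrier G \<union> (\<lambda>a. rot a \<otimes>\<^bsub>DG\<^esub> dihedral_x G) ` carrier G"
        using dihedral_cases[OF g] by auto
    qed
    then show "finite (carrier DG)"
      using assms(1) by (meson finite_Un finite_imageI finite_subset)
    show "subgroup (rot ` carrier G) DG"
      by (rule rot.img_is_subgroup)
    from assms(2) obtain a where a: "a \<in> carrier G" "a \<otimes> a \<noteq> \<one>"
      by (auto simp: elementary_abelian_def comm_group_axioms numeral_2_eq_2)
    \<comment> \<open>Injectivity of \<open>rot\<close> carries the nontrivial square over from the
      abelian group.\<close>
    then have "rot a \<otimes>\<^bsub>DG\<^esub> rot a \<noteq> \<one>\<^bsub>DG\<^esub>"
      using rot_inj by (metis inj_on_eq_iff m_closed one_closed rot.hom_one rot_mult)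
    then show "\<exists>a\<in>rot ` carrier G. a \<otimes>\<^bsub>DG\<^esub> a \<noteq> \<one>\<^bsub>DG\<^esub>"
      using a by auto
    show "dihedral_x G \<otimes>\<^bsub>DG\<^esub> r \<otimes>\<^bsub>DG\<^esub> dihedral_x G = inv\<^bsub>DG\<^esub> r"
      if "r \<in> rot ` carrier G" for r
      using that dihedral_x_conj by blast
  qed (rule group_DG dihedral_x_closed dihedral_x_square dihedral_x_not_rot dihedral_cases,
      assumption?)+
qed

end

theorem theorem4p2:
  fixes A :: "('a, 'm) monoid_scheme" and n :: nat
  assumes "comm_group A"
    and "finite (carrier A)"
    and "order A = n"
    and "\<not> elementary_abelian 2 A"
  shows
    "(faithful_action (gen_dihedral A) (carrier (gen_dihedral A))
        (left_regular_action (gen_dihedral A)) \<and>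
      transitive_action (gen_dihedral A) (carrier (gen_dihedral A))
        (left_regular_action (gen_dihedral A)) \<and>
      card (carrier (gen_dihedral A)) = 2 * n \<and>
      EKR_property (gen_dihedral A) (carrier (gen_dihedral A))
        (left_regular_action (gen_dihedral A)) \<and>
      EKR_robust (gen_dihedral A) (carrier (gen_dihedral A))
        (left_regular_action (gen_dihedral A)))
     \<and>
     (faithful_action (gen_dihedral A) (lcosets\<^bsub>gen_dihedral A\<^esub> (dihedral_H A))
        (left_coset_action (gen_dihedral A) (dihedral_H A)) \<and>
      transitive_action (gen_dihedral A) (lcosets\<^bsub>gen_dihedral A\<^esub> (dihedral_H A))
        (left_coset_action (gen_dihedral A) (dihedral_H A)) \<and>
      card (lcosets\<^bsub>gen_dihedral A\<^esub> (dihedral_H A)) = n \<and>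
      EKR_property (gen_dihedral A) (lcosets\<^bsub>gen_dihedral A\<^esub> (dihedral_H A))
        (left_coset_action (gen_dihedral A) (dihedral_H A)) \<and>
      EKR_robust (gen_dihedral A) (lcosets\<^bsub>gen_dihedral A\<^esub> (dihedral_H A))
        (left_coset_action (gen_dihedral A) (dihedral_H A)))"
proof -
  interpret A: comm_group A by fact
  interpret D: dihedral_extension "gen_dihedral A" "A.rot ` carrier A" "dihedral_x A"
    using assms by (intro A.dihedral_extension_gen_dihedral)
  have H: "dihedral_H A = D.H"
    by (simp add: dihedral_H_def)
  have n: "card (A.rot ` carrier A) = n"
    using assms(3) A.rot_inj by (simp add: card_image order_def)
  \<comment> \<open>The nonidentity element for robustness of the regular action is the reflection:
    it lies outside the subgroup of rotations, which contains the identity.\<close>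
  show ?thesis
    unfolding H
    using D.faithful_left_regular D.transitive_left_regular D.card_carrier D.card_lcosets n
      D.EKR_property_left_regular[OF D.finite_carrier]
      D.EKR_robust_left_regular[OF D.finite_carrier D.x(1)] D.x(2)
      subgroup.one_closed[OF D.N] D.faithful_left_coset D.transitive_left_coset[OF D.subgroup_H]
      D.EKR_property_left_coset D.EKR_robust_left_coset
    by metis
qed

end
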